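(* Let $t, r$ be integers with $t \ge r \ge 2$, and let $n = 2(t-r+1)$. Then the $(t,r)$ broadcast domination number of the Cartesian product $C_n \Box C_n$ is $\gamma_{t,r}(C_n \Box C_n) = 2$. (Consequently, together with $\gamma_{t,r}(C_n)=2$, one has $\gamma_{t,r}(C_n \Box C_n) < \gamma_{t,r}(C_n)\gamma_{t,r}(C_n)$.)
   Context: Let $G=(V,E)$ be a graph and fix integers $t \ge r \ge 1$. For $D \subseteq V$ and $v \in V$, the reception at $v$ is $r(v) = \sum_{u \in D,\ \mathrm{dist}(u,v) \le t} (t - \mathrm{dist}(u,v))$, where $\mathrm{dist}$ is graph distance. $D$ is a $(t,r)$ broadcast dominating set if $r(v) \ge r$ for every $v \in V$; $\gamma_{t,r}(G)$ is the minimum cardinality of such a set. $C_n$ is the cycle on $n$ vertices (for $n=2$, two vertices joined by an edge). The Cartesian product $G \Box H$ has vertex set $V_G \times V_H$, with $(g_1,h_1)$ adjacent to $(g_2,h_2)$ iff either $g_1=g_2$ and $h_1h_2 \in E_H$, or $h_1=h_2$ and $g_1g_2 \in E_G$. *)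

theory Defs
  imports "Graph_Theory.Graph_Theory"
begin

text \<open>
  A finite simple undirected graph is a symmetric, loop-free, finite \<^typ>\<open>'a pair_pre_digraph\<close>
  (the locale \<^locale>\<open>pair_graph\<close>), each undirected edge being a pair of opposite arcs.
\<close>

text \<open>
  The cycle on \<open>{0..<n}\<close>, meant for \<open>n \<ge> 2\<close>. Arcs form a set of pairs, so for \<open>n = 2\<close> this is
  two vertices joined by a single edge.
\<close>

definition cycle_graph :: "nat \<Rightarrow> nat pair_pre_digraph" where
  "cycle_graph n =
    \<lparr> pverts = {..<n},
      parcs = {(i, j). i < n \<and> j < n \<and> (j = Suc i mod n \<or> i = Suc j mod n)} \<rparr>"

definition cart_prod ::
    "'a pair_pre_digraph \<Rightarrow> 'b pair_pre_digraph \<Rightarrow> ('a \<times> 'b) pair_pre_digraph"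
    (infixr \<open>\<box>\<close> 80) where
  "G \<box> H =
    \<lparr> pverts = pverts G \<times> pverts H,
      parcs = {((g1, h1), (g2, h2)).
        (g1 = g2 \<and> g1 \<in> pverts G \<and> (h1, h2) \<in> parcs H) \<or>
        (h1 = h2 \<and> h1 \<in> pverts H \<and> (g1, g2) \<in> parcs G)} \<rparr>"

text \<open>Unit weights make the cost of a walk its length; unreachable vertices are at distance \<open>\<infinity>\<close>.\<close>

definition graph_dist :: "'a pair_pre_digraph \<Rightarrow> 'a \<Rightarrow> 'a \<Rightarrow> ereal" where
  "graph_dist G u v = wf_digraph.\<mu> (with_proj G) (\<lambda>_. 1) u v"

definition reception :: "'a pair_pre_digraph \<Rightarrow> nat \<Rightarrow> 'a set \<Rightarrow> 'a \<Rightarrow> ereal" where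
  "reception G t D v =
    (\<Sum>u \<in> {u \<in> D. graph_dist G u v \<le> ereal (real t)}. ereal (real t) - graph_dist G u v)"

definition broadcast_dominating :: "'a pair_pre_digraph \<Rightarrow> nat \<Rightarrow> nat \<Rightarrow> 'a set \<Rightarrow> bool" where
  "broadcast_dominating G t r D \<longleftrightarrow>
    D \<subseteq> pverts G \<and> (\<forall>v \<in> pverts G. reception G t D v \<ge> ereal (real r))"

definition broadcast_domination_number :: "'a pair_pre_digraph \<Rightarrow> nat \<Rightarrow> nat \<Rightarrow> nat" where
  "broadcast_domination_number G t r =
    (LEAST k. \<exists>D. finite D \<and> broadcast_dominating G t r D \<and> card D = k)"

lemma pair_graph_cycle_graph:
  assumes "n \<ge> 2"
  shows "pair_graph (cycle_graph n)"
proof -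
  have ne: "Suc i mod n \<noteq> i" if "i < n" for i
    using that assms by (cases "Suc i = n") auto
  have fin: "finite (parcs (cycle_graph n))"
    by (rule finite_subset[of _ "{..<n} \<times> {..<n}"]) (auto simp: cycle_graph_def)
  show ?thesis
  proof
    show "finite (parcs (cycle_graph n))" by (rule fin)
    show "symmetric (with_proj (cycle_graph n))"
      by (auto simp: symmetric_def sym_def arcs_ends_def arc_to_ends_def cycle_graph_def)
  qed (use ne in \<open>force simp: cycle_graph_def\<close>)+
qed

lemma pair_graph_cart_prod:
  assumes "pair_graph G" and "pair_graph H"
  shows "pair_graph (G \<box> H)"
proof -
  interpret G: pair_graph G by fact
  interpret H: pair_graph H by fact
  have fin: "finite (parcs (G \<box> H))"
    by (rule finite_subset[of _ "(pverts G \<times> pverts H) \<times> (pverts G \<times> pverts H)"])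
       (auto simp: cart_prod_def dest: G.wellformed H.wellformed)
  show ?thesis
  proof
    show "finite (parcs (G \<box> H))" by (rule fin)
    show "symmetric (with_proj (G \<box> H))"
      using G.sym_arcs H.sym_arcs
      by (auto simp: symmetric_def sym_def arcs_ends_def arc_to_ends_def cart_prod_def)
  qed (auto simp: cart_prod_def dest: G.wellformed H.wellformed G.no_loops H.no_loops)
qed

end

theory Submission
  imports Defs
begin

text \<open>
  Put \<open>m = t - r + 1\<close>, so \<open>n = 2m\<close>. Every vertex of the cycle or of the torus has a vertex at
  distance at least \<open>m\<close>, at which it contributes at most \<open>t - m = r - 1\<close>; so one broadcasting vertex
  is not enough. Two antipodal vertices are: on the cycle the distances from any vertex to \<open>0\<close> and
  \<open>m\<close> sum to \<open>m\<close>, hence on the torus the distances to \<open>(0, 0)\<close> and \<open>(m, m)\<close> sum to \<open>2m\<close>, which gives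
  reception at least \<open>2t - 2m = 2r - 2 \<ge> r\<close>.
\<close>

section \<open>Bounds on graph distance\<close>

lemma graph_dist_le_relpow:
  assumes "pair_wf_digraph G" "u \<in> pverts G" "(u, v) \<in> parcs G ^^ k"
  shows "graph_dist G u v \<le> ereal (real k)"
proof -
  interpret pair_wf_digraph G by fact
  have "\<exists>p. awalk u p v \<and> length p = k"
    using assms(2,3)
  proof (induction k arbitrary: u)
    case 0
    then show ?case by (auto simp: awalk_Nil_iff)
  next
    case (Suc k)
    obtain w where w: "(u, w) \<in> parcs G" "(w, v) \<in> parcs G ^^ k"
      using Suc.prems(2) by (blast dest: relpow_Suc_D2)
    obtain p where "awalk w p v" "length p = k"
      using Suc.IH[OF in_arcsD2[OF w(1)] w(2)] by blast
    then show ?case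
      using w(1) by (intro exI[of _ "(u, w) # p"]) (auto simp: awalk_Cons_iff)
  qed
  then obtain p where "awalk u p v" "length p = k" by blast
  then show ?thesis
    using min_cost_le_walk_cost[of u p v "\<lambda>_. 1"]
    by (simp add: graph_dist_def awalk_cost_def sum_list_triv)
qed

text \<open>Along a walk \<open>f\<close> rises by at most the number of arcs, and the distance is
  the infimum of walk lengths. Distances are thus bounded below without being computed.\<close>

lemma graph_dist_ge_Lipschitz:
  fixes f :: "'a \<Rightarrow> int"
  assumes "pair_wf_digraph G" and lip: "\<And>x y. (x, y) \<in> parcs G \<Longrightarrow> f y \<le> f x + 1"
  shows "ereal (of_int (f v - f u)) \<le> graph_dist G u v"
proof -
  interpret pair_wf_digraph G by fact
  have "f v - f u \<le> int (length p)" if "awalk u p v" for p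
    using that
  proof (induction p arbitrary: u)
    case Nil
    then show ?case by (auto simp: awalk_Nil_iff)
  next
    case (Cons e p)
    then have "e \<in> parcs G" "u = fst e" "f v - f (snd e) \<le> int (length p)"
      by (auto simp: awalk_Cons_iff)
    moreover have "f (snd e) \<le> f (fst e) + 1"
      using lip[of "fst e" "snd e"] \<open>e \<in> parcs G\<close> by simp
    ultimately show ?case by simp
  qed
  then have "real_of_int (f v - f u) \<le> real (length p)" if "awalk u p v" for p
    using that by (metis of_int_le_iff of_int_of_nat_eq)
  then show ?thesis
    unfolding graph_dist_def \<mu>_def
    by (intro INF_greatest) (simp add: awalk_cost_def sum_list_triv)
qed

section \<open>Reception and domination by two vertices\<close>

text \<open>The bound \<open>k u\<close> may exceed \<open>t\<close>: its summand is then negative,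
  while a vertex out of range contributes 0. So no range check is needed.\<close>

lemma reception_ge:
  assumes "finite D" "\<And>u. u \<in> D \<Longrightarrow> graph_dist G u v \<le> ereal (k u)"
  shows "ereal (\<Sum>u\<in>D. real t - k u) \<le> reception G t D v"
proof -
  have "ereal (\<Sum>u\<in>D. real t - k u) = (\<Sum>u\<in>D. ereal (real t - k u))"
    by simp
  also have "\<dots> \<le> (\<Sum>u\<in>D. if graph_dist G u v \<le> ereal (real t)
                          then ereal (real t) - graph_dist G u v else 0)"
  proof (rule sum_mono)
    fix u assume "u \<in> D"
    from assms(2)[OF this] show "ereal (real t - k u) \<le>
        (if graph_dist G u v \<le> ereal (real t) then ereal (real t) - graph_dist G u v else 0)"
      by (cases "graph_dist G u v") auto
  qed
  also have "\<dots> = reception G t D v"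
    using assms(1) by (simp add: reception_def sum.inter_filter)
  finally show ?thesis .
qed

lemma reception_singleton_less:
  assumes "ereal (real m) \<le> graph_dist G u v" "t < m + r" "0 < r"
  shows "reception G t {u} v < ereal (real r)"
proof (cases "graph_dist G u v \<le> ereal (real t)")
  case True
  then have "{x \<in> {u}. graph_dist G x v \<le> ereal (real t)} = {u}" by auto
  then show ?thesis
    using assms True by (cases "graph_dist G u v") (auto simp: reception_def)
next
  case False
  then have "{x \<in> {u}. graph_dist G x v \<le> ereal (real t)} = {}" by auto
  then show ?thesis
    using assms by (simp add: reception_def del: Collect_empty_eq)
qed

text \<open>The argument shared by cycle and torus: the empty set yields reception 0 <
  \<open>r\<close>, and a single vertex fails at the far vertex supplied by
  \<open>far\<close>.\<close>

lemma broadcast_domination_number_eq_2: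
  assumes "pverts G \<noteq> {}" "0 < r" "t < m + r"
    and far: "\<And>u. u \<in> pverts G \<Longrightarrow> \<exists>v\<in>pverts G. ereal (real m) \<le> graph_dist G u v"
    and "u \<noteq> w" "broadcast_dominating G t r {u, w}"
  shows "broadcast_domination_number G t r = 2"
  unfolding broadcast_domination_number_def
proof (rule Least_equality)
  show "\<exists>D. finite D \<and> broadcast_dominating G t r D \<and> card D = 2"
    using assms(5,6) by (intro exI[of _ "{u, w}"]) auto
next
  fix k assume "\<exists>D. finite D \<and> broadcast_dominating G t r D \<and> card D = k"
  then obtain D where D: "finite D" "broadcast_dominating G t r D" "card D = k" by blast
  have "D \<noteq> {}"
    using D(2) assms(1,2) by (auto simp: broadcast_dominating_def reception_def)
  moreover have "D \<noteq> {x}" for x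
  proof
    assume "D = {x}"
    then have "x \<in> pverts G" and dom: "\<And>v. v \<in> pverts G \<Longrightarrow> ereal (real r) \<le> reception G t {x} v"
      using D(2) by (auto simp: broadcast_dominating_def)
    then obtain v where "v \<in> pverts G" "ereal (real m) \<le> graph_dist G x v"
      using far by blast
    then show False
      using reception_singleton_less[OF _ assms(3,2)] dom by (meson leD)
  qed
  ultimately have "k \<noteq> 0" "k \<noteq> 1"
    using D(1,3) by (auto simp: card_1_singleton_iff)
  then show "2 \<le> k" by simp
qed

text \<open>Walk lengths bound the distances from above, so the reception is at least
  \<open>(t - k) + (t - l)\<close>. The condition is written additively to avoid truncated
  subtraction.\<close>

lemma broadcast_dominating_pairI:
  assumes "u \<in> pverts G" "w \<in> pverts G" "u \<noteq> w" "pair_wf_digraph G"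
    and near: "\<And>v. v \<in> pverts G \<Longrightarrow>
      \<exists>k l. (u, v) \<in> parcs G ^^ k \<and> (w, v) \<in> parcs G ^^ l \<and> k + l + r \<le> 2 * t"
  shows "broadcast_dominating G t r {u, w}"
  unfolding broadcast_dominating_def
proof (intro conjI ballI)
  show "{u, w} \<subseteq> pverts G" using assms by simp
next
  fix v assume "v \<in> pverts G"
  then obtain k l where kl: "(u, v) \<in> parcs G ^^ k" "(w, v) \<in> parcs G ^^ l" "k + l + r \<le> 2 * t"
    using near by blast
  have "graph_dist G u v \<le> ereal (real k)" "graph_dist G w v \<le> ereal (real l)"
    using assms kl by (auto intro: graph_dist_le_relpow)
  then have "ereal (\<Sum>x\<in>{u, w}. real t - (if x = u then real k else real l))
      \<le> reception G t {u, w} v"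
    using \<open>u \<noteq> w\<close> by (intro reception_ge) auto
  moreover have "real k + real l + real r \<le> 2 * real t"
    using kl(3) by linarith
  ultimately show "ereal (real r) \<le> reception G t {u, w} v"
    using \<open>u \<noteq> w\<close> by (auto elim!: order_trans[rotated])
qed

section \<open>Walks in products and cycles\<close>

text \<open>Walk in \<open>G\<close> with second coordinate \<open>b\<close>, then in
  \<open>H\<close> with first coordinate \<open>c\<close>; a coordinate held fixed must be a
  vertex.\<close>

lemma cart_prod_relpow:
  assumes "b \<in> pverts H" "c \<in> pverts G"
    and "(a, c) \<in> parcs G ^^ k" "(b, d) \<in> parcs H ^^ l"
  shows "((a, b), (c, d)) \<in> parcs (G \<box> H) ^^ (k + l)"
proof -
  have "((a, b), (c, b)) \<in> parcs (G \<box> H) ^^ k"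
    using assms(3)
  proof (induction k arbitrary: c)
    case (Suc k)
    then obtain x where "(a, x) \<in> parcs G ^^ k" "(x, c) \<in> parcs G" by auto
    with Suc.IH[of x] show ?case
      using assms(1) by (auto simp: cart_prod_def intro!: relcompI)
  qed simp
  moreover have "((c, b), (c, d)) \<in> parcs (G \<box> H) ^^ l"
    using assms(4)
  proof (induction l arbitrary: d)
    case (Suc l)
    then obtain x where "(b, x) \<in> parcs H ^^ l" "(x, d) \<in> parcs H" by auto
    with Suc.IH[of x] show ?case
      using assms(2) by (auto simp: cart_prod_def intro!: relcompI)
  qed simp
  ultimately show ?thesis by (auto simp: relpow_add)
qed

lemma cycle_graph_relpow_up:
  assumes "i + k < n"
  shows "(i, i + k) \<in> parcs (cycle_graph n) ^^ k"
  using assms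
  by (induction k) (auto simp: cycle_graph_def intro!: relcompI)

lemma cycle_graph_relpow_down:
  assumes "i + k < n"
  shows "(i + k, i) \<in> parcs (cycle_graph n) ^^ k"
  using assms
proof (induction k)
  case (Suc k)
  then have "(i + Suc k, i + k) \<in> parcs (cycle_graph n)" by (simp add: cycle_graph_def)
  then show ?case by (rule relpow_Suc_I2) (use Suc in simp)
qed simp

text \<open>The vertices 0 and \<open>m\<close> cut the cycle into two paths of length
  \<open>m\<close>. The walks from both ends to \<open>v\<close> cover the path containing
  \<open>v\<close> once.\<close>

lemma cycle_graph_antipodal_relpow:
  assumes "v < 2 * m"
  shows "\<exists>k l. (0, v) \<in> parcs (cycle_graph (2 * m)) ^^ k
    \<and> (m, v) \<in> parcs (cycle_graph (2 * m)) ^^ l \<and> k + l = m"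
proof (cases "v \<le> m")
  case True
  then show ?thesis
    using cycle_graph_relpow_up[of 0 v "2 * m"] cycle_graph_relpow_down[of v "m - v" "2 * m"] assms
    by (intro exI[of _ v] exI[of _ "m - v"]) auto
next
  case False
  \<comment> \<open>In the upper half the walk from 0 first crosses the wrap-around edge and then
    descends: \<open>2 * m - v\<close> arcs in all.\<close>
  have "(0, 2 * m - 1) \<in> parcs (cycle_graph (2 * m))"
    using assms by (simp add: cycle_graph_def)
  moreover have "(2 * m - 1, v) \<in> parcs (cycle_graph (2 * m)) ^^ (2 * m - 1 - v)"
    using cycle_graph_relpow_down[of v "2 * m - 1 - v" "2 * m"] assms by simp
  ultimately have "(0, v) \<in> parcs (cycle_graph (2 * m)) ^^ Suc (2 * m - 1 - v)"
    by (rule relpow_Suc_I2)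
  moreover have "(m, v) \<in> parcs (cycle_graph (2 * m)) ^^ (v - m)"
    using cycle_graph_relpow_up[of m "v - m" "2 * m"] False assms by simp
  ultimately show ?thesis
    using False assms by (intro exI[of _ "Suc (2 * m - 1 - v)"] exI[of _ "v - m"]) auto
qed

section \<open>Lower bound on cycle distance\<close>

text \<open>For \<open>a, b < n\<close> this is the length of the shorter way round. It is
  integer-valued, to serve as a Lipschitz function.\<close>

definition circular_dist :: "nat \<Rightarrow> nat \<Rightarrow> nat \<Rightarrow> int" where
  "circular_dist n a b = min \<bar>int a - int b\<bar> (int n - \<bar>int a - int b\<bar>)"

lemma circular_dist_Lipschitz:
  assumes "a < n" "(x, y) \<in> parcs (cycle_graph n)"
  shows "circular_dist n a y \<le> circular_dist n a x + 1"
proof -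
  have xy: "x < n" "y < n" and step: "y = Suc x mod n \<or> x = Suc y mod n"
    using assms(2) by (auto simp: cycle_graph_def)
  \<comment> \<open>Without \<open>mod\<close>: a unit step changes each argument of
    \<open>min\<close> by 1; crossing between 0 and \<open>n - 1\<close> swaps the two arguments up
    to 1.\<close>
  have "y = Suc x \<or> (y = 0 \<and> n = Suc x) \<or> x = Suc y \<or> (x = 0 \<and> n = Suc y)"
    using step xy by (metis Suc_lessI mod_less mod_self)
  then show ?thesis
    using assms(1) xy unfolding circular_dist_def by (elim disjE) auto
qed

lemma circular_dist_self: "circular_dist n a a = 0"
  by (simp add: circular_dist_def)

lemma circular_dist_antipode:
  assumes "a < 2 * m"
  obtains b where "b < 2 * m" "circular_dist (2 * m) a b = int m"
proof (cases "a < m")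
  case True
  then show ?thesis by (intro that[of "a + m"]) (auto simp: circular_dist_def)
next
  case False
  then show ?thesis using assms by (intro that[of "a - m"]) (auto simp: circular_dist_def)
qed

section \<open>The cycle and the torus\<close>

lemma pverts_cycle_graph [simp]: "pverts (cycle_graph n) = {..<n}"
  by (simp add: cycle_graph_def)

lemma pverts_cart_prod [simp]: "pverts (G \<box> H) = pverts G \<times> pverts H"
  by (simp add: cart_prod_def)

theorem theorem2:
  fixes t r n :: nat
  assumes "t \<ge> r" and "r \<ge> 2"
    and "n = 2 * (t - r + 1)"
  shows "broadcast_domination_number (cycle_graph n \<box> cycle_graph n) t r = 2
    \<and> broadcast_domination_number (cycle_graph n) t r = 2
    \<and> broadcast_domination_number (cycle_graph n \<box> cycle_graph n) t r
        < broadcast_domination_number (cycle_graph n) t r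
          * broadcast_domination_number (cycle_graph n) t r"
proof -
  define m where "m = t - r + 1"
  let ?C = "cycle_graph n" and ?T = "cycle_graph n \<box> cycle_graph n"
  have n: "n = 2 * m" and m: "0 < m" "m < n" "t < m + r" "m + r \<le> t + 1"
    using assms by (auto simp: m_def)
  have "pair_graph ?C"
    using n m by (intro pair_graph_cycle_graph) simp
  moreover from this have "pair_graph ?T"
    by (intro pair_graph_cart_prod)
  ultimately have wf: "pair_wf_digraph ?C" "pair_wf_digraph ?T"
    by (simp_all add: pair_graph.axioms pair_graph_def pair_digraph_def pair_fin_digraph_def)
  have "broadcast_dominating ?C t r {0, m}"
  proof (rule broadcast_dominating_pairI)
    fix v assume "v \<in> pverts ?C"
    then obtain k l where "(0, v) \<in> parcs ?C ^^ k" "(m, v) \<in> parcs ?C ^^ l" "k + l = m"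
      using cycle_graph_antipodal_relpow[of v m] n by auto
    then show "\<exists>k l. (0, v) \<in> parcs ?C ^^ k \<and> (m, v) \<in> parcs ?C ^^ l \<and> k + l + r \<le> 2 * t"
      \<comment> \<open>Here \<open>k + l + r = m + r = t + 1 \<le> 2 * t\<close>.\<close>
      using m assms by (intro exI[of _ k] exI[of _ l]) auto
  qed (use m wf in auto)
  moreover have "\<exists>v\<in>pverts ?C. ereal (real m) \<le> graph_dist ?C u v" if "u \<in> pverts ?C" for u
  proof -
    from that obtain v where v: "v < n" "circular_dist n u v = int m"
      using circular_dist_antipode[of u m] n by auto
    then show ?thesis
      using graph_dist_ge_Lipschitz[OF wf(1), of "circular_dist n u" v u] that
      by (intro bexI[of _ v]) (auto simp: circular_dist_self circular_dist_Lipschitz)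
  qed
  ultimately have C: "broadcast_domination_number ?C t r = 2"
    using m assms by (intro broadcast_domination_number_eq_2[of _ r t m 0 m]) auto
  have "broadcast_dominating ?T t r {(0, 0), (m, m)}"
  proof (rule broadcast_dominating_pairI)
    fix v assume "v \<in> pverts ?T"
    then obtain x y where v: "v = (x, y)" "x < n" "y < n" by auto
    obtain k l where kl: "(0, x) \<in> parcs ?C ^^ k" "(m, x) \<in> parcs ?C ^^ l" "k + l = m"
      using cycle_graph_antipodal_relpow[of x m] v n by auto
    obtain k' l' where kl': "(0, y) \<in> parcs ?C ^^ k'" "(m, y) \<in> parcs ?C ^^ l'" "k' + l' = m"
      using cycle_graph_antipodal_relpow[of y m] v n by auto
    have "((0, 0), v) \<in> parcs ?T ^^ (k + k')" "((m, m), v) \<in> parcs ?T ^^ (l + l')"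
      using kl kl' v m wf by (auto intro!: cart_prod_relpow)
    \<comment> \<open>The left side equals \<open>2 * m + r = 2 * t + 2 - r\<close>, so this is
      where \<open>r \<ge> 2\<close> enters.\<close>
    moreover have "(k + k') + (l + l') + r \<le> 2 * t"
      using kl(3) kl'(3) m assms by linarith
    ultimately show "\<exists>k l. ((0, 0), v) \<in> parcs ?T ^^ k \<and> ((m, m), v) \<in> parcs ?T ^^ l
        \<and> k + l + r \<le> 2 * t"
      by blast
  qed (use m wf in auto)
  moreover have "\<exists>v\<in>pverts ?T. ereal (real m) \<le> graph_dist ?T u v" if "u \<in> pverts ?T" for u
  proof -
    from that obtain a b where u: "u = (a, b)" "a < n" "b < n" by auto
    then obtain c where c: "c < n" "circular_dist n a c = int m"
      using circular_dist_antipode[of a m] n by auto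
    \<comment> \<open>The first coordinate alone gives the distance \<open>m\<close>: an arc of the
      torus either fixes it or moves it along an arc of the cycle. The far vertex
      \<open>(c, b)\<close> therefore keeps the second coordinate of \<open>u\<close>.\<close>
    have "circular_dist n a (fst q) \<le> circular_dist n a (fst p) + 1" if "(p, q) \<in> parcs ?T" for p q
      using that u by (auto simp: cart_prod_def circular_dist_Lipschitz)
    then have "ereal (of_int (circular_dist n a (fst (c, b)) - circular_dist n a (fst u)))
        \<le> graph_dist ?T u (c, b)"
      by (rule graph_dist_ge_Lipschitz[OF wf(2)])
    then show ?thesis
      using u c by (intro bexI[of _ "(c, b)"]) (auto simp: circular_dist_self)
  qed
  ultimately have "broadcast_domination_number ?T t r = 2"
    using m assms by (intro broadcast_domination_number_eq_2[of _ r t m "(0, 0)" "(m, m)"]) auto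
  with C show ?thesis by simp
qed

end
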